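(* Let $H_Q$ be a nonzero finite-dimensional complex Hilbert space, let $U_1,U_2$ be unitary operators on $H_Q$, and let $\eta_1,\eta_2\geq 0$ be prior probabilities with $\eta_1+\eta_2=1$. Let $H_R$ be any nonzero finite-dimensional complex Hilbert space (an ancilla). Then for every error margin $m\in[0,1]$, the maximum success probability $P_{\max}(m)$ of discriminating the two unitaries $U_1\otimes 1_R$, $U_2\otimes 1_R$ on $H_Q\otimes H_R$ with priors $\eta_1,\eta_2$ equals the maximum success probability $P_{\max}(m)$ of discriminating $U_1,U_2$ on $H_Q$ with the same priors. That is, entanglement with an ancilla does not help in discriminating two unitary processes.
   Context: Unitary-process discrimination with error margin. Given unitary operators $U_1,\dots,U_n$ on a nonzero finite-dimensional complex Hilbert space $H$ and prior probabilities $\eta_1,\dots,\eta_n$ ($\eta_i\ge0$, $\sum_i\eta_i=1$), a strategy consists of an input state $\rho$ (a density operator on $H$) and a POVM $\{E_0,E_1,\dots,E_n\}$ on $H$ (positive semidefinite operators with $\sum_{\mu=0}^nE_\mu=1$). Outcome $\mu\in\{1,\dots,n\}$ means "guess $U_\mu$" and outcome $0$ is inconclusive. The success and mean error probabilities are $$P_\circ=\sum_{i=1}^n\eta_i\,\mathrm{tr}(U_i\rho U_i^\dagger E_i),\qquad P_\times=\sum_{i\ne j,\ i,j\in\{1,\dots,n\}}\eta_i\,\mathrm{tr}(U_i\rho U_i^\dagger E_j).$$ For $m\in[0,1]$, $P_{\max}(m)$ is the maximum of $P_\circ$ over all strategies with $P_\times\le m$. Here $n=2$; with the ancilla, input states and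 POVMs are arbitrary ones on $H_Q\otimes H_R$. *)

theory Defs
  imports "HOL-Analysis.Analysis"
begin

text \<open>
  An operator on a nonzero finite-dimensional complex Hilbert space is given by its matrix in an
  orthonormal basis indexed by a finite type \<open>'d\<close>. Types are nonempty, so the space is nonzero.
\<close>

type_synonym 'd cop = "complex ^ 'd ^ 'd"

definition cinner :: "complex ^ 'd::finite \<Rightarrow> complex ^ 'd \<Rightarrow> complex" where
  "cinner v w = (\<Sum>i\<in>UNIV. cnj (v $ i) * w $ i)"

definition dagger :: "'d::finite cop \<Rightarrow> 'd cop" where
  "dagger A = (\<chi> i j. cnj (A $ j $ i))"

definition unitary_op :: "'d::finite cop \<Rightarrow> bool" where
  "unitary_op U \<longleftrightarrow> dagger U ** U = mat 1 \<and> U ** dagger U = mat 1"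

definition psd_op :: "'d::finite cop \<Rightarrow> bool" where
  "psd_op A \<longleftrightarrow> dagger A = A \<and> (\<forall>v. 0 \<le> Re (cinner v (A *v v)))"

definition density_op :: "'d::finite cop \<Rightarrow> bool" where
  "density_op \<rho> \<longleftrightarrow> psd_op \<rho> \<and> trace \<rho> = 1"

text \<open>The tensor product is expressed in the product of the two orthonormal bases.\<close>

definition tensor_op :: "'q::finite cop \<Rightarrow> 'r::finite cop \<Rightarrow> ('q \<times> 'r) cop" where
  "tensor_op A B = (\<chi> i j. A $ fst i $ fst j * B $ snd i $ snd j)"

text \<open>Outcome \<open>0\<close> is the inconclusive one; values of \<open>E\<close> above \<open>n\<close> are irrelevant.\<close>

definition povm :: "nat \<Rightarrow> (nat \<Rightarrow> 'd::finite cop) \<Rightarrow> bool" where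
  "povm n E \<longleftrightarrow> (\<forall>\<mu>\<in>{0..n}. psd_op (E \<mu>)) \<and> (\<Sum>\<mu>\<in>{0..n}. E \<mu>) = mat 1"

text \<open>The trace below is real when \<open>\<rho>\<close> and \<open>F\<close> are positive semidefinite, so \<open>Re\<close> only
  changes its type.\<close>

definition outcome_prob :: "'d::finite cop \<Rightarrow> 'd cop \<Rightarrow> 'd cop \<Rightarrow> real" where
  "outcome_prob U \<rho> F = Re (trace (U ** \<rho> ** dagger U ** F))"

definition success_prob ::
  "nat \<Rightarrow> (nat \<Rightarrow> real) \<Rightarrow> (nat \<Rightarrow> 'd::finite cop) \<Rightarrow> 'd cop \<Rightarrow> (nat \<Rightarrow> 'd cop) \<Rightarrow> real" where
  "success_prob n \<eta> U \<rho> E = (\<Sum>i\<in>{1..n}. \<eta> i * outcome_prob (U i) \<rho> (E i))"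

definition error_prob ::
  "nat \<Rightarrow> (nat \<Rightarrow> real) \<Rightarrow> (nat \<Rightarrow> 'd::finite cop) \<Rightarrow> 'd cop \<Rightarrow> (nat \<Rightarrow> 'd cop) \<Rightarrow> real" where
  "error_prob n \<eta> U \<rho> E =
     (\<Sum>i\<in>{1..n}. \<Sum>j\<in>{1..n} - {i}. \<eta> i * outcome_prob (U i) \<rho> (E j))"

definition success_values ::
  "nat \<Rightarrow> (nat \<Rightarrow> real) \<Rightarrow> (nat \<Rightarrow> 'd::finite cop) \<Rightarrow> real \<Rightarrow> real set" where
  "success_values n \<eta> U m =
     {success_prob n \<eta> U \<rho> E | \<rho> E. density_op \<rho> \<and> povm n E \<and> error_prob n \<eta> U \<rho> E \<le> m}"

definition is_max_success ::
  "nat \<Rightarrow> (nat \<Rightarrow> real) \<Rightarrow> (nat \<Rightarrow> 'd::finite cop) \<Rightarrow> real \<Rightarrow> real \<Rightarrow> bool" where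
  "is_max_success n \<eta> U m p \<longleftrightarrow>
     p \<in> success_values n \<eta> U m \<and> (\<forall>x\<in>success_values n \<eta> U m. x \<le> p)"

text \<open>\<open>P_max\<close> is meaningful only when the maximum is attained; statements about it should
  also assert \<open>is_max_success\<close>.\<close>

definition P_max ::
  "nat \<Rightarrow> (nat \<Rightarrow> real) \<Rightarrow> (nat \<Rightarrow> 'd::finite cop) \<Rightarrow> real \<Rightarrow> real" where
  "P_max n \<eta> U m = (THE p. is_max_success n \<eta> U m p)"

end

theory Submission
  imports Defs
begin

text \<open>
  Both discrimination problems realise the same set of success probabilities. Write
  \<open>\<rho> = \<Sum>\<^sub>k |v\<^sub>k\<rangle>\<langle>v\<^sub>k|\<close>. The statistics of a strategy depend only on the two vectors \<open>(V\<^sub>i v\<^sub>k)\<^sub>k\<close>, \<open>i = 1, 2\<close>,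
  of the orthogonal sum, and a POVM can be transferred to any pair of vectors with the same Gram
  matrix by compression with an isometry. The overlap \<open>\<Sum>\<^sub>k \<langle>V\<^sub>1 v\<^sub>k, V\<^sub>2 v\<^sub>k\<rangle>\<close> is a convex combination
  of overlaps \<open>\<langle>U\<^sub>1 x, U\<^sub>2 x\<rangle>\<close> of unit vectors \<open>x\<close>, and by the Toeplitz--Hausdorff theorem it is itself
  such an overlap, so a pure input without ancilla does equally well. The maximum is attained by
  compactness.
\<close>

section \<open>Matrices and the complex inner product\<close>

lemma cinner_add_left: "cinner (x + y) z = cinner x z + cinner y z"
  by (simp add: cinner_def algebra_simps sum.distrib)

lemma cinner_add_right: "cinner x (y + z) = cinner x y + cinner x z"
  by (simp add: cinner_def algebra_simps sum.distrib)

lemma cinner_diff_left: "cinner (x - y) z = cinner x z - cinner y z"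
  by (simp add: cinner_def algebra_simps sum_subtractf)

lemma cinner_diff_right: "cinner x (y - z) = cinner x y - cinner x z"
  by (simp add: cinner_def algebra_simps sum_subtractf)

lemma cinner_scale_left: "cinner (c *s x) y = cnj c * cinner x y"
  by (simp add: cinner_def sum_distrib_left mult_ac)

lemma cinner_scale_right: "cinner x (c *s y) = c * cinner x y"
  by (simp add: cinner_def sum_distrib_left mult_ac)

lemma cinner_zero_left [simp]: "cinner 0 x = 0"
  by (simp add: cinner_def)

lemma cinner_zero_right [simp]: "cinner x 0 = 0"
  by (simp add: cinner_def)

lemma cinner_commute: "cinner x y = cnj (cinner y x)"
  by (simp add: cinner_def mult.commute)

lemma cinner_self: "cinner x x = of_real ((norm x)\<^sup>2)"
proof -
  have "(norm x)\<^sup>2 = (\<Sum>i\<in>UNIV. (norm (x $ i))\<^sup>2)"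
    by (simp add: norm_vec_def L2_set_def sum_nonneg)
  then show ?thesis
    by (simp add: cinner_def complex_norm_square[symmetric] mult.commute[of "cnj _"])
qed

lemma sum_cinner_self_eq_1_iff:
  "(\<Sum>k\<in>K. cinner (v k) (v k)) = 1 \<longleftrightarrow> (\<Sum>k\<in>K. (norm (v k))\<^sup>2) = 1"
  unfolding cinner_self of_real_sum[symmetric] of_real_eq_1_iff ..

lemma cinner_self_eq_1_iff: "cinner x x = 1 \<longleftrightarrow> norm x = 1"
  unfolding cinner_self of_real_eq_1_iff by (simp add: power2_eq_1_iff) (smt (verit) norm_ge_zero)

lemma cinner_sum_right: "cinner x (\<Sum>k\<in>K. f k) = (\<Sum>k\<in>K. cinner x (f k))"
  by (induction K rule: infinite_finite_induct) (simp_all add: cinner_add_right)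

lemmas cinner_linear = cinner_add_left cinner_add_right cinner_diff_left cinner_diff_right
  cinner_scale_left cinner_scale_right

lemma cinner_axis: "cinner (axis i 1) x = x $ i"
proof -
  have "cinner (axis i 1) x = (\<Sum>j\<in>UNIV. if j = i then x $ j else 0)"
    unfolding cinner_def axis_def by (intro sum.cong) auto
  then show ?thesis by simp
qed

lemma norm_scale: "norm (c *s x) = cmod c * norm x" for x :: "complex ^ 'n::finite"
proof -
  have "complex_of_real ((norm (c *s x))\<^sup>2) = (c * cnj c) * of_real ((norm x)\<^sup>2)"
    unfolding cinner_self[symmetric] by (simp add: cinner_linear)
  also have "\<dots> = of_real ((cmod c * norm x)\<^sup>2)"
    by (simp add: complex_norm_square[symmetric] power_mult_distrib)
  finally have "(norm (c *s x))\<^sup>2 = (cmod c * norm x)\<^sup>2"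
    by (simp only: of_real_eq_iff)
  then show ?thesis by simp
qed

text \<open>\<open>dagger\<close> applies to square matrices only, while the maps \<open>J k\<close>
  that later carry a POVM from one space to another are rectangular.\<close>

definition adj :: "complex ^ 'a::finite ^ 'b::finite \<Rightarrow> complex ^ 'b ^ 'a" where
  "adj A = (\<chi> i j. cnj (A $ j $ i))"

lemma dagger_eq_adj: "dagger A = adj A"
  by (simp add: dagger_def adj_def)

lemma cinner_adj: "cinner x (A *v y) = cinner (adj A *v x) y"
proof -
  have "cinner x (A *v y) = (\<Sum>i\<in>UNIV. \<Sum>j\<in>UNIV. cnj (x $ i) * (A $ i $ j * y $ j))"
    by (simp add: cinner_def matrix_vector_mult_def sum_distrib_left)
  also have "\<dots> = (\<Sum>j\<in>UNIV. \<Sum>i\<in>UNIV. cnj (x $ i) * (A $ i $ j * y $ j))"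
    by (rule sum.swap)
  also have "\<dots> = cinner (adj A *v x) y"
    by (simp add: cinner_def matrix_vector_mult_def adj_def sum_distrib_left sum_distrib_right
        mult_ac)
  finally show ?thesis .
qed

lemma adj_adj [simp]: "adj (adj A) = A"
  by (simp add: adj_def vec_eq_iff)

lemma adj_mult: "adj (A ** B) = adj B ** adj A"
  by (simp add: adj_def vec_eq_iff matrix_matrix_mult_def mult.commute)

lemma adj_add: "adj (A + B) = adj A + adj B"
  by (simp add: adj_def vec_eq_iff)

lemma adj_diff: "adj (A - B) = adj A - adj B"
  by (simp add: adj_def vec_eq_iff)

lemma adj_sum: "adj (\<Sum>k\<in>K. f k) = (\<Sum>k\<in>K. adj (f k))"
  by (simp add: adj_def vec_eq_iff)

lemma matrix_vector_sum_left: "(\<Sum>k\<in>K. A k) *v x = (\<Sum>k\<in>K. A k *v x)"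
  for A :: "_ \<Rightarrow> complex ^ 'n::finite ^ 'm::finite"
  by (induction K rule: infinite_finite_induct) (simp_all add: matrix_vector_mult_add_rdistrib)

text \<open>Pairing with \<open>axis i 1\<close> reads off the \<open>i\<close>-th coordinate, so
  the forms determine \<open>A *v y\<close> and hence the matrix.\<close>

lemma matrix_eqI_cinner:
  fixes A B :: "complex ^ 'a::finite ^ 'b::finite"
  assumes "\<And>x y. cinner x (A *v y) = cinner x (B *v y)"
  shows "A = B"
proof -
  have "A *v y = B *v y" for y
    using assms by (metis cinner_axis vec_eq_iff)
  then show ?thesis by (simp add: matrix_eq)
qed

section \<open>Rank-one operators |x><y| and traces against them\<close>

definition outer :: "complex ^ 'b::finite \<Rightarrow> complex ^ 'a::finite \<Rightarrow> complex ^ 'a ^ 'b" where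
  "outer x y = (\<chi> i j. x $ i * cnj (y $ j))"

lemma outer_apply: "outer x y *v z = cinner y z *s x"
  by (simp add: vec_eq_iff outer_def matrix_vector_mult_def cinner_def sum_distrib_left
      sum_distrib_right mult_ac)

lemma adj_outer: "adj (outer x y) = outer y x"
  by (simp add: vec_eq_iff outer_def adj_def mult.commute)

lemma trace_outer_mult: "trace (outer x y ** F) = cinner y (F *v x)"
proof -
  have "trace (outer x y ** F) = (\<Sum>i\<in>UNIV. \<Sum>j\<in>UNIV. cnj (y $ j) * (F $ j $ i * x $ i))"
    by (simp add: trace_def outer_def matrix_matrix_mult_def mult_ac)
  also have "\<dots> = (\<Sum>j\<in>UNIV. \<Sum>i\<in>UNIV. cnj (y $ j) * (F $ j $ i * x $ i))"
    by (rule sum.swap)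
  finally show ?thesis
    by (simp add: cinner_def matrix_vector_mult_def sum_distrib_left)
qed

lemma trace_outer: "trace (outer x y) = cinner y x"
  using trace_outer_mult[of x y "mat 1"] by simp

lemma conj_outer: "A ** outer x y ** adj B = outer (A *v x) (B *v y)"
  by (rule matrix_eqI_cinner)
     (simp add: matrix_vector_mul_assoc[symmetric] outer_apply cinner_adj
        vector_scalar_commute)

lemma trace_sum: "trace (\<Sum>k\<in>K. A k) = (\<Sum>k\<in>K. trace (A k))"
  for A :: "_ \<Rightarrow> complex ^ 'n::finite ^ 'n"
  by (induction K rule: infinite_finite_induct) (simp_all add: trace_add trace_0[unfolded mat_0])

lemma matrix_mult_sum_left: "A ** (\<Sum>k\<in>K. B k) = (\<Sum>k\<in>K. A ** B k)"
  for A :: "complex ^ 'b::finite ^ 'c::finite" and B :: "_ \<Rightarrow> complex ^ 'a::finite ^ 'b"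
  by (induction K rule: infinite_finite_induct) (simp_all add: matrix_add_ldistrib)

lemma matrix_mult_sum_right: "(\<Sum>k\<in>K. B k) ** A = (\<Sum>k\<in>K. B k ** A)"
  for A :: "complex ^ 'a::finite ^ 'b::finite" and B :: "_ \<Rightarrow> complex ^ 'b ^ 'c::finite"
  by (simp add: vec_eq_iff matrix_matrix_mult_def sum_distrib_right sum.swap[of _ K])

text \<open>Conjugation by \<open>A\<close> turns each \<open>outer (v k) (v k)\<close> into the
  rank-one operator of \<open>A *v v k\<close>, whose trace against \<open>F\<close> is a quadratic
  form. The statistics of a strategy thus depend on the state only through these vectors.\<close>

lemma outcome_prob_outer_sum:
  "outcome_prob A (\<Sum>k\<in>K. outer (v k) (v k)) F
    = (\<Sum>k\<in>K. Re (cinner (A *v v k) (F *v (A *v v k))))"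
  by (simp add: outcome_prob_def dagger_eq_adj matrix_mult_sum_left matrix_mult_sum_right
      trace_sum conj_outer trace_outer_mult)

section \<open>Positive semidefinite operators and their decomposition into rank-one terms\<close>

lemma psd_op_add: "psd_op A \<Longrightarrow> psd_op B \<Longrightarrow> psd_op (A + B)"
  by (simp add: psd_op_def dagger_eq_adj adj_add matrix_vector_mult_add_rdistrib cinner_add_right)

lemma psd_op_0: "psd_op 0"
  by (simp add: psd_op_def dagger_def vec_eq_iff)

lemma psd_op_sum: "(\<And>k. k \<in> K \<Longrightarrow> psd_op (A k)) \<Longrightarrow> psd_op (\<Sum>k\<in>K. A k)"
  by (induction K rule: infinite_finite_induct) (simp_all add: psd_op_add psd_op_0)

lemma cinner_conj: "cinner x ((adj J ** F ** J) *v y) = cinner (J *v x) (F *v (J *v y))"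
  by (simp add: matrix_vector_mul_assoc[symmetric] cinner_adj[of _ "adj J"])

lemma psd_op_conj: "psd_op F \<Longrightarrow> psd_op (adj J ** F ** J)"
  by (simp add: psd_op_def cinner_conj dagger_eq_adj adj_mult matrix_mul_assoc)

lemma psd_op_outer: "psd_op (outer x x)"
  by (simp add: psd_op_def dagger_eq_adj adj_outer outer_apply cinner_scale_right
      cinner_commute[of _ x] mult.commute[of "cnj _"] complex_mult_cnj)

lemma matrix_vector_axis: "A *v axis i 1 = (\<chi> j. A $ j $ i)"
  for A :: "complex ^ 'n::finite ^ 'm::finite"
  by (simp add: vec_eq_iff matrix_vector_mult_def axis_def if_distrib[of "(*) _"] cong: if_cong)

lemma psd_op_diag:
  assumes "psd_op A"
  shows "A $ i $ i = of_real (Re (A $ i $ i))" "0 \<le> Re (A $ i $ i)"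
proof -
  have "cnj (A $ i $ i) = A $ i $ i"
    using assms by (simp add: psd_op_def dagger_def vec_eq_iff)
  then show "A $ i $ i = of_real (Re (A $ i $ i))"
    by (metis Reals_cnj_iff of_real_Re)
  have "cinner (axis i 1) (A *v axis i 1) = A $ i $ i"
    by (simp add: cinner_axis matrix_vector_axis)
  then show "0 \<le> Re (A $ i $ i)"
    using assms unfolding psd_op_def by metis
qed

text \<open>The form is evaluated at \<open>c *s axis i 1 + axis j 1\<close>, where the phase
  \<open>c\<close> turns both cross terms into \<open>- cmod (A $ i $ j)\<close>. The bound serves
  twice: a zero diagonal forces the operator to vanish, and the set of strategies is
  bounded.\<close>

lemma psd_op_offdiag:
  assumes "psd_op A"
  shows "2 * cmod (A $ i $ j) \<le> Re (A $ i $ i) + Re (A $ j $ j)"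
proof (cases "A $ i $ j = 0")
  case True
  then show ?thesis using psd_op_diag(2)[OF assms] by (simp add: add_nonneg_nonneg)
next
  case False
  define c where "c = - sgn (A $ i $ j)"
  have ji: "A $ j $ i = cnj (A $ i $ j)"
    using assms by (simp add: psd_op_def dagger_def vec_eq_iff)
  have "cmod c = 1"
    using False by (simp add: c_def norm_sgn)
  then have c: "cnj c * c = 1"
    using complex_norm_square[of c] by (simp add: mult.commute)
  have ca: "cnj c * A $ i $ j = - of_real (cmod (A $ i $ j))"
  proof -
    have "cnj c * A $ i $ j = - (A $ i $ j * cnj (A $ i $ j)) / of_real (cmod (A $ i $ j))"
      by (simp add: c_def sgn_div_norm scaleR_conv_of_real divide_inverse)
    also have "\<dots> = - of_real (cmod (A $ i $ j))"
      using False by (simp add: complex_norm_square[symmetric] power2_eq_square)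
    finally show ?thesis .
  qed
  have "cinner (c *s axis i 1 + axis j 1) (A *v (c *s axis i 1 + axis j 1))
      = cnj c * c * A $ i $ i + cnj c * A $ i $ j + (cnj (cnj c * A $ i $ j)) + A $ j $ j"
    by (simp add: matrix_vector_right_distrib vector_scalar_commute cinner_linear cinner_axis
        matrix_vector_axis ji algebra_simps)
  then have "Re (cinner (c *s axis i 1 + axis j 1) (A *v (c *s axis i 1 + axis j 1)))
      = Re (A $ i $ i) + Re (A $ j $ j) - 2 * cmod (A $ i $ j)"
    by (simp add: c ca)
  moreover have "0 \<le> Re (cinner (c *s axis i 1 + axis j 1) (A *v (c *s axis i 1 + axis j 1)))"
    using assms by (simp add: psd_op_def)
  ultimately show ?thesis by simp
qed

text \<open>One step of Cholesky elimination: the form of \<open>A - outer u u\<close> at \<open>x\<close> is that of \<open>A\<close> at \<open>x\<close>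
  shifted along the \<open>i\<close>-th axis.\<close>

lemma psd_op_schur:
  assumes A: "psd_op A" and nz: "A $ i $ i \<noteq> 0"
  defines "u \<equiv> of_real (1 / sqrt (Re (A $ i $ i))) *s (A *v axis i 1)"
  shows "psd_op (A - outer u u)" "(A - outer u u) $ i $ i = 0"
    "A $ j $ j = 0 \<Longrightarrow> (A - outer u u) $ j $ j = 0"
proof -
  define a where "a = Re (A $ i $ i)"
  define y where "y = A *v axis i 1"
  have Aii: "A $ i $ i = of_real a"
    unfolding a_def by (rule psd_op_diag(1)[OF A])
  have a: "a > 0"
  proof -
    have "0 \<le> a"
      unfolding a_def by (rule psd_op_diag(2)[OF A])
    moreover have "a \<noteq> 0" using nz Aii by auto
    ultimately show ?thesis by simp
  qed
  have herm: "adj A = A"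
    using A by (simp add: psd_op_def dagger_eq_adj)
  have yi: "y $ i = of_real a"
    by (simp add: y_def matrix_vector_axis Aii)
  have u: "u = of_real (1 / sqrt a) *s y"
    by (simp add: u_def a_def y_def)
  have sq: "of_real (1 / sqrt a) * of_real (1 / sqrt a) = (of_real (1 / a) :: complex)"
    using a by (simp flip: of_real_mult add: real_sqrt_mult_self)
  have form: "cinner x ((A - outer u u) *v x)
      = cinner x (A *v x) - of_real (1 / a) * (cinner x y * cinner y x)" for x
  proof -
    have "cinner x (outer u u *v x)
        = (of_real (1 / sqrt a) * of_real (1 / sqrt a)) * (cinner x y * cinner y x)"
      by (simp add: outer_apply u cinner_linear)
    then show ?thesis
      by (simp only: sq matrix_vector_mult_diff_rdistrib cinner_diff_right)
  qed
  have shift: "cinner x (A *v x) - of_real (1 / a) * (cinner x y * cinner y x)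
      = cinner (x - (cinner y x / of_real a) *s axis i 1)
          (A *v (x - (cinner y x / of_real a) *s axis i 1))" for x
  proof -
    have "cinner (axis i 1) (A *v x) = cinner y x"
      by (simp add: cinner_adj herm y_def)
    moreover have "cnj (cinner y x) = cinner x y"
      using cinner_commute[of x y] by simp
    ultimately show ?thesis
      using a by (simp add: matrix_vector_mult_diff_distrib vector_scalar_commute cinner_linear
          cinner_axis yi flip: y_def)
  qed
  show "psd_op (A - outer u u)"
    unfolding psd_op_def
  proof (intro conjI allI)
    show "dagger (A - outer u u) = A - outer u u"
      by (simp add: dagger_eq_adj adj_diff herm adj_outer)
    show "0 \<le> Re (cinner x ((A - outer u u) *v x))" for x
      unfolding form shift using A unfolding psd_op_def by blast
  qed
  have out: "outer u u $ j $ j = of_real (1 / a) * (y $ j * cnj (y $ j))" for j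
  proof -
    have "outer u u $ j $ j
        = (of_real (1 / sqrt a) * of_real (1 / sqrt a)) * (y $ j * cnj (y $ j))"
      by (simp add: outer_def u)
    then show ?thesis by (simp only: sq)
  qed
  show "(A - outer u u) $ i $ i = 0"
    using a by (simp add: out yi Aii)
  assume Aj: "A $ j $ j = 0"
  \<comment> \<open>When \<open>A $ j $ j = 0\<close>, the new entry is minus the squared modulus of
    \<open>y $ j\<close> over \<open>a\<close>. Positivity then forces \<open>y $ j = 0\<close>, so
    a cleared diagonal entry stays cleared.\<close>
  have "Re ((A - outer u u) $ j $ j) \<ge> 0"
    using psd_op_diag(2)[OF \<open>psd_op (A - outer u u)\<close>] .
  then have "(cmod (y $ j))\<^sup>2 / a \<le> 0"
    by (simp add: out Aj complex_norm_square[symmetric] del: of_real_power)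
  then have "y $ j = 0"
    using a by (simp add: divide_le_0_iff)
  then show "(A - outer u u) $ j $ j = 0"
    by (simp add: out Aj)
qed

lemma psd_op_zero_diag:
  assumes "psd_op A" "\<And>i. A $ i $ i = 0"
  shows "A = 0"
  using psd_op_offdiag[OF assms(1)] assms(2) by (simp add: vec_eq_iff)

text \<open>Induction on the number of nonzero diagonal entries. Each elimination step clears one of
  them and creates none; once all are zero, the operator itself is zero and the empty sum represents
  it.\<close>

lemma psd_op_decomp:
  fixes A :: "'d::finite cop"
  assumes "psd_op A"
  shows "\<exists>(N::nat) v. A = (\<Sum>k<N. outer (v k) (v k))"
  using assms
proof (induction "card {i. A $ i $ i \<noteq> 0}" arbitrary: A rule: less_induct)
  case less
  show ?case
  proof (cases "\<exists>i. A $ i $ i \<noteq> 0")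
    case False
    then have "A = (\<Sum>k<0::nat. outer ((\<lambda>_. 0::complex ^ 'd) k) 0)"
      using psd_op_zero_diag[OF less.prems] by (simp add: lessThan_0)
    then show ?thesis by (intro exI[of _ "0::nat"]) simp
  next
    case True
    then obtain i where i: "A $ i $ i \<noteq> 0" by blast
    define u where "u = of_real (1 / sqrt (Re (A $ i $ i))) *s (A *v axis i 1)"
    note schur = psd_op_schur[OF less.prems i, folded u_def]
    have "{j. (A - outer u u) $ j $ j \<noteq> 0} \<subset> {j. A $ j $ j \<noteq> 0}"
      using schur(2,3) i by blast
    then have "card {j. (A - outer u u) $ j $ j \<noteq> 0} < card {j. A $ j $ j \<noteq> 0}"
      by (intro psubset_card_mono) auto
    then obtain N :: nat and v where v: "A - outer u u = (\<Sum>k<N. outer (v k) (v k))"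
      using less.hyps schur(1) by blast
    have "A = (\<Sum>k<Suc N. outer ((v(N := u)) k) ((v(N := u)) k))"
      using v by (simp add: algebra_simps)
    then show ?thesis by blast
  qed
qed

section \<open>Convexity of the numerical range\<close>

text \<open>This is the numerical range of \<open>adj A ** B\<close>. For unitaries it collects the
  inner products of the two output vectors that one unit input vector can produce.\<close>

definition overlaps :: "'d::finite cop \<Rightarrow> 'd cop \<Rightarrow> complex set" where
  "overlaps A B = {cinner (A *v x) (B *v x) | x. norm x = 1}"

text \<open>Toeplitz--Hausdorff. After normalising the two given values to \<open>0\<close> and \<open>1\<close>, the phase
  \<open>c\<close> makes the cross term real, so the form is real along the segment from \<open>c *s x\<close> to \<open>y\<close>
  and the intermediate value theorem applies.\<close>

lemma convex_overlaps: "convex (overlaps A B)"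
  unfolding convex_alt
proof (intro ballI allI impI)
  fix p q and t :: real
  assume "p \<in> overlaps A B" "q \<in> overlaps A B" and t: "0 \<le> t \<and> t \<le> 1"
  then obtain x y where x: "norm x = 1" "p = cinner (A *v x) (B *v x)"
    and y: "norm y = 1" "q = cinner (A *v y) (B *v y)"
    unfolding overlaps_def by blast
  show "(1 - t) *\<^sub>R p + t *\<^sub>R q \<in> overlaps A B"
  proof (cases "p = q")
    case True
    then have "(1 - t) *\<^sub>R p + t *\<^sub>R q = p"
      by (simp add: algebra_simps)
    then show ?thesis using \<open>p \<in> overlaps A B\<close> by simp
  next
    case False
    define b where "b x y = (cinner (A *v x) (B *v y) - p * cinner x y) / (q - p)" for x y
    note lin = matrix_vector_right_distrib vector_scalar_commute cinner_linear
    have b: "b (c *s x + d *s y) (c *s x + d *s y)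
        = cnj c * c * b x x + (cnj c * d * b x y + cnj d * c * b y x) + cnj d * d * b y y"
      for c d x y
      by (simp add: b_def lin diff_divide_distrib add_divide_distrib algebra_simps)
    have bxx: "b x x = 0" and byy: "b y y = 1"
      using x y False by (simp_all add: b_def cinner_self)
    \<comment> \<open>With this choice \<open>cnj u * b x y + u * b y x\<close> is the difference of
      the squared moduli of \<open>b x y\<close> and \<open>b y x\<close>, hence real. If
      \<open>u = 0\<close>, the cross terms are conjugate to each other and \<open>c = 1\<close>
      suffices.\<close>
    define u where "u = b x y - cnj (b y x)"
    define c where "c = (if u = 0 then 1 else sgn u)"
    have c1: "cmod c = 1"
      by (simp add: c_def norm_sgn)
    have "Im (cnj c * b x y + c * b y x) = 0"
    proof (cases "u = 0")
      case True
      then show ?thesis by (simp add: c_def u_def complex_eq_iff)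
    next
      case False
      have "Im (cnj u * b x y + u * b y x) = 0"
        by (simp add: u_def algebra_simps)
      moreover have "cnj c * b x y + c * b y x = (cnj u * b x y + u * b y x) /\<^sub>R cmod u"
        using False by (simp add: c_def sgn_div_norm algebra_simps)
      ultimately show ?thesis by simp
    qed
    then obtain r where r: "cnj c * b x y + c * b y x = of_real r"
      by (metis complex_is_Real_iff Reals_cases)
    define z where "z s = (of_real (1 - s) * c) *s x + of_real s *s y" for s :: real
    have bz: "b (z s) (z s) = of_real (s * (1 - s) * r + s\<^sup>2)" for s
    proof -
      have "b (z s) (z s) = of_real (s * (1 - s)) * (cnj c * b x y + c * b y x) + of_real (s\<^sup>2)"
        unfolding z_def b by (simp add: bxx byy algebra_simps power2_eq_square)
      then show ?thesis by (simp add: r)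
    qed
    \<comment> \<open>At a zero of \<open>g\<close> the form at \<open>z s\<close> is
      \<open>t\<close> times the squared norm of \<open>z s\<close>, so after normalisation
      \<open>z s\<close> gives exactly the value \<open>t\<close>.\<close>
    define g where "g s = (s * (1 - s) * r + s\<^sup>2) - t * (norm (z s))\<^sup>2" for s
    have z01: "norm (z 0) = 1" "norm (z 1) = 1"
      by (simp_all add: z_def norm_scale c1 x y)
    have "continuous_on {0..1} z"
      unfolding z_def vec_eq_iff vector_scalar_mult_def plus_vec_def
      by (intro continuous_intros)
    then have "continuous_on {0..1} g"
      unfolding g_def by (intro continuous_intros)
    moreover have "g 0 \<le> 0" "0 \<le> g 1"
      using t by (simp_all add: g_def z01)
    ultimately obtain s where s: "0 \<le> s" "s \<le> 1" "g s = 0"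
      using IVT'[of g 0 0 1] by auto
    \<comment> \<open>Since \<open>x\<close> and \<open>y\<close> are unit vectors and
      \<open>c\<close> is a phase, \<open>z s = 0\<close> would force \<open>s = 1/2\<close> and
      \<open>y = - (c *s x)\<close>. The form would then agree at \<open>x\<close> and
      \<open>y\<close>, but its values there are 0 and 1.\<close>
    have nz: "z s \<noteq> 0"
    proof
      assume 0: "z s = 0"
      then have "(of_real (1 - s) * c) *s x = - (of_real s *s y)"
        by (simp add: z_def add_eq_0_iff2)
      then have "norm ((of_real (1 - s) * c) *s x) = norm (of_real s *s y)"
        by simp
      then have "1 - s = s"
        using s(1,2) by (simp add: norm_scale norm_mult c1 x y del: of_real_diff)
      then have half: "s = 1/2" by simp
      define d where "d = - c"
      have yd: "y = d *s x"
        using 0 by (simp add: z_def half d_def vec_eq_iff add_eq_0_iff2)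
      have "cnj d * d = 1"
        using c1 by (simp add: d_def mult.commute[of "cnj _"] complex_norm_square[symmetric])
      then have "b y y = b x x"
        unfolding yd b_def by (simp add: lin algebra_simps flip: mult.assoc)
      then show False by (simp add: bxx byy)
    qed
    define n where "n = norm (z s)"
    have n: "n > 0" using nz by (simp add: n_def)
    have bn: "b (z s) (z s) = of_real (t * n\<^sup>2)"
      using s(3) bz[of s] by (simp add: g_def n_def)
    define w where "w = of_real (1 / n) *s z s"
    have nw: "norm w = 1"
      using n by (simp add: w_def norm_scale) (simp add: n_def norm_divide)
    have "b w w = of_real t"
    proof -
      have "b w w = of_real (1 / n) * of_real (1 / n) * b (z s) (z s)"
        using b[of "of_real (1/n)" "z s" 0 0] by (simp add: w_def)
      also have "\<dots> = of_real (1 / n * (1 / n) * (t * n\<^sup>2))"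
        by (simp only: bn of_real_mult)
      finally show ?thesis using n by (simp add: power2_eq_square)
    qed
    then have "cinner (A *v w) (B *v w) - p = of_real t * (q - p)"
      using False by (simp add: b_def cinner_self nw field_simps)
    then have "(1 - t) *\<^sub>R p + t *\<^sub>R q = cinner (A *v w) (B *v w)"
      by (simp add: scaleR_conv_of_real algebra_simps)
    then show ?thesis using nw unfolding overlaps_def by blast
  qed
qed

text \<open>Each term is the squared norm of \<open>v k\<close> times the overlap of a unit vector,
  so the sum is a convex combination of elements of a convex set. A zero \<open>v k\<close> has
  weight 0 and is assigned the arbitrary unit vector \<open>e\<close>.\<close>

lemma sum_overlaps:
  fixes A B :: "'d::finite cop"
  assumes K: "finite K" and one: "(\<Sum>k\<in>K. (norm (v k))\<^sup>2) = 1"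
  shows "(\<Sum>k\<in>K. cinner (A *v v k) (B *v v k)) \<in> overlaps A B"
proof -
  define e :: "complex ^ 'd" where "e = axis undefined 1"
  define x where "x k = (if v k = 0 then e else of_real (1 / norm (v k)) *s v k)" for k
  have x: "norm (x k) = 1" for k
    by (simp add: x_def e_def norm_scale) (simp add: norm_divide)
  have vx: "v k = of_real (norm (v k)) *s x k" for k
    by (simp add: x_def vector_smult_assoc del: of_real_divide flip: of_real_mult)
  have "cinner (A *v v k) (B *v v k) = (norm (v k))\<^sup>2 *\<^sub>R cinner (A *v x k) (B *v x k)" for k
    by (subst (1 2) vx)
       (simp add: vector_scalar_commute cinner_linear scaleR_conv_of_real power2_eq_square)
  moreover have "(\<Sum>k\<in>K. (norm (v k))\<^sup>2 *\<^sub>R cinner (A *v x k) (B *v x k)) \<in> overlaps A B"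
    using K convex_overlaps one
    by (rule convex_sum) (auto simp: overlaps_def x)
  ultimately show ?thesis by simp
qed

lemma adj_mat_1: "adj (mat 1) = mat 1"
  by (simp add: adj_def mat_def vec_eq_iff)

lemma psd_op_mat_1: "psd_op (mat 1)"
  by (simp add: psd_op_def dagger_eq_adj adj_mat_1 cinner_self)

section \<open>Transferring a strategy\<close>

lemma atLeast0_atMost2: "{0..2::nat} = {0, 1, 2}"
  by auto

lemma atLeast1_atMost2: "{1..2::nat} = {1, 2}"
  by auto

text \<open>Equal Gram matrices give an isometry \<open>J\<close> from the span of \<open>a1, a2\<close> with \<open>J a1 = b1\<close> and
  \<open>J a2 = b2\<close>; here \<open>b1, b2\<close> live in an orthogonal sum indexed by \<open>K\<close> and \<open>J k\<close> are the
  components. When \<open>a1, a2\<close> are dependent, \<open>w = 0\<close> and \<open>si = inverse 0 = 0\<close>.\<close>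

lemma povm_pullback:
  fixes a1 a2 :: "complex ^ 'b::finite" and b1 b2 :: "'k \<Rightarrow> complex ^ 'a::finite"
  assumes E: "povm 2 E"
    and a1: "cinner a1 a1 = 1" and a2: "cinner a2 a2 = 1"
    and b1: "(\<Sum>k\<in>K. cinner (b1 k) (b1 k)) = 1"
    and b2: "(\<Sum>k\<in>K. cinner (b2 k) (b2 k)) = 1"
    and b12: "(\<Sum>k\<in>K. cinner (b1 k) (b2 k)) = cinner a1 a2"
  obtains E' where "povm 2 E'"
    "\<And>\<mu>. \<mu> \<noteq> 0 \<Longrightarrow> cinner a1 (E' \<mu> *v a1) = (\<Sum>k\<in>K. cinner (b1 k) (E \<mu> *v b1 k))"
    "\<And>\<mu>. \<mu> \<noteq> 0 \<Longrightarrow> cinner a2 (E' \<mu> *v a2) = (\<Sum>k\<in>K. cinner (b2 k) (E \<mu> *v b2 k))"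
proof -
  \<comment> \<open>A sum over an infinite index set is 0 by convention, which contradicts
    \<open>b1\<close>.\<close>
  have K: "finite K"
    using b1 by (rule_tac ccontr) simp
  define z where "z = cinner a1 a2"
  have z': "cinner a2 a1 = cnj z"
    using cinner_commute[of a2 a1] by (simp add: z_def)
  \<comment> \<open>Gram-Schmidt: \<open>w\<close> is the part of \<open>a2\<close> orthogonal to
    \<open>a1\<close>. Its counterpart \<open>wb\<close> uses the same coefficient \<open>z\<close>,
    because the Gram matrices agree; hence both have the squared norm \<open>s\<close>.\<close>
  define w where "w = a2 - z *s a1"
  define wb where "wb k = b2 k - z *s b1 k" for k
  define s where "s = cinner w w"
  define si where "si = inverse s"
  have si: "si * s * si = si"
    by (cases "s = 0") (simp_all add: si_def)
  have s: "s = 1 - z * cnj z"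
    by (simp add: s_def w_def cinner_linear a1 a2 z' algebra_simps flip: z_def)
  have si_cnj: "cnj si = si"
    by (simp add: si_def s_def cinner_self)
  have a1w: "cinner a1 w = 0" and wa1: "cinner w a1 = 0"
    by (simp_all add: w_def cinner_linear a1 z' flip: z_def)
  have b21: "(\<Sum>k\<in>K. cinner (b2 k) (b1 k)) = cnj z"
    unfolding z_def b12[symmetric] cnj_sum by (intro sum.cong refl cinner_commute)
  have sb1w: "(\<Sum>k\<in>K. cinner (b1 k) (wb k)) = 0"
    by (simp add: wb_def cinner_linear sum_subtractf b12 b1 flip: sum_distrib_left z_def)
  have swb1: "(\<Sum>k\<in>K. cinner (wb k) (b1 k)) = 0"
    by (simp add: wb_def cinner_linear sum_subtractf b21 b1 flip: sum_distrib_left)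
  have sww: "(\<Sum>k\<in>K. cinner (wb k) (wb k)) = s"
  proof -
    have "(\<Sum>k\<in>K. cinner (wb k) (wb k))
        = (\<Sum>k\<in>K. cinner (b2 k) (wb k)) - cnj z * (\<Sum>k\<in>K. cinner (b1 k) (wb k))"
      by (simp add: wb_def[of k for k] cinner_diff_left cinner_scale_left sum_subtractf
          sum_distrib_left)
    also have "\<dots> = 1 - z * cnj z"
      unfolding sb1w
      by (simp add: wb_def cinner_linear sum_subtractf b21 b2 flip: sum_distrib_left)
    finally show ?thesis by (simp add: s)
  qed
  define J where "J k = outer (b1 k) a1 + outer (wb k) (si *s w)" for k
  have J: "J k *v x = cinner a1 x *s b1 k + (si * cinner w x) *s wb k" for k x
    by (simp add: J_def matrix_vector_mult_add_rdistrib outer_apply cinner_scale_left si_cnj)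
  \<comment> \<open>The orthogonal projection onto the span of \<open>a1\<close> and
    \<open>a2\<close>. By \<open>JJ\<close> below, the components \<open>J k\<close> together form a
    partial isometry with this initial projection.\<close>
  define P where "P = outer a1 a1 + outer w (si *s w)"
  have P: "P *v x = cinner a1 x *s a1 + (si * cinner w x) *s w" for x
    by (simp add: P_def matrix_vector_mult_add_rdistrib outer_apply cinner_scale_left si_cnj)
  have JJ: "(\<Sum>k\<in>K. adj (J k) ** J k) = P"
  proof (rule matrix_eqI_cinner)
    fix x y
    have cnjs: "cnj (cinner a1 x) = cinner x a1" "cnj (cinner w x) = cinner x w"
      using cinner_commute by metis+
    have "cinner x ((\<Sum>k\<in>K. adj (J k) ** J k) *v y) = (\<Sum>k\<in>K. cinner (J k *v x) (J k *v y))"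
      using cinner_conj[of x "J k" "mat 1" y for k]
      by (simp add: matrix_vector_sum_left cinner_sum_right)
    also have "\<dots> = cinner x a1 * cinner a1 y * (\<Sum>k\<in>K. cinner (b1 k) (b1 k))
        + cinner x a1 * (si * cinner w y) * (\<Sum>k\<in>K. cinner (b1 k) (wb k))
        + si * cinner x w * cinner a1 y * (\<Sum>k\<in>K. cinner (wb k) (b1 k))
        + si * cinner x w * (si * cinner w y) * (\<Sum>k\<in>K. cinner (wb k) (wb k))"
      by (simp add: J cinner_linear cnjs si_cnj sum_distrib_left sum.distrib algebra_simps)
    also have "\<dots> = cinner x a1 * cinner a1 y + (si * s * si) * cinner x w * cinner w y"
      by (simp add: b1 sb1w swb1 sww)
    also have "\<dots> = cinner x (P *v y)"
      unfolding si by (simp add: P cinner_linear)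
    finally show "cinner x ((\<Sum>k\<in>K. adj (J k) ** J k) *v y) = cinner x (P *v y)" .
  qed
  have PP: "P *v (P *v y) = P *v y" for y
  proof -
    have "cinner a1 (P *v y) = cinner a1 y"
      by (simp add: P cinner_linear a1 a1w)
    moreover have "cinner w (P *v y) = si * cinner w y * s"
      by (simp add: P cinner_linear wa1 s_def)
    moreover have "si * (si * cinner w y * s) = si * cinner w y"
      using si by (metis mult.assoc mult.commute)
    ultimately show ?thesis
      using P[of "P *v y"] P[of y] by simp
  qed
  have "adj P = P"
    by (simp add: JJ[symmetric] adj_sum adj_mult)
  then have Q: "adj (mat 1 - P) = mat 1 - P"
    by (simp add: adj_diff adj_mat_1)
  \<comment> \<open>A self-adjoint idempotent is the conjugate of the identity by itself, hence
    positive semidefinite.\<close>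
  have "(mat 1 - P) = adj (mat 1 - P) ** mat 1 ** (mat 1 - P)"
    unfolding Q
    by (simp add: matrix_eq matrix_vector_mul_assoc[symmetric] matrix_vector_mult_diff_rdistrib
        matrix_vector_mult_diff_distrib PP)
  then have psdQ: "psd_op (mat 1 - P)"
    using psd_op_conj[OF psd_op_mat_1, of "mat 1 - P"] by simp
  \<comment> \<open>The compressed effects sum only to \<open>P\<close>. The remainder
    \<open>mat 1 - P\<close> is given to the inconclusive outcome, so the effects of both guesses
    are pure compressions.\<close>
  define E' where "E' \<mu> = (\<Sum>k\<in>K. adj (J k) ** E \<mu> ** J k) + (if \<mu> = 0 then mat 1 - P else 0)"
    for \<mu> :: nat
  have form: "cinner x (E' \<mu> *v x) = (\<Sum>k\<in>K. cinner (J k *v x) (E \<mu> *v (J k *v x)))"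
    if "\<mu> \<noteq> 0" for \<mu> x
    using that by (simp add: E'_def matrix_vector_sum_left cinner_sum_right cinner_conj)
  have Ja1: "J k *v a1 = b1 k" for k
    by (simp add: J a1 wa1)
  \<comment> \<open>If \<open>s = 0\<close>, then \<open>wb\<close> vanishes on \<open>K\<close> as
    well, so \<open>b2 k = z *s b1 k\<close> and the default \<open>si = 0\<close> does no
    harm.\<close>
  have Ja2: "J k *v a2 = b2 k" if "k \<in> K" for k
  proof (cases "s = 0")
    case True
    then have "(\<Sum>k\<in>K. (norm (wb k))\<^sup>2) = 0"
      using sww unfolding cinner_self by (metis of_real_sum of_real_eq_0_iff)
    then have "wb k = 0"
      using K that by (simp add: sum_nonneg_eq_0_iff)
    then show ?thesis
      by (simp add: J wb_def flip: z_def)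
  next
    case False
    have "a2 = w + z *s a1" by (simp add: w_def)
    then have "cinner w a2 = s"
      by (metis add_cancel_left_right cinner_add_right cinner_scale_right mult_zero_right s_def wa1
          add.commute)
    then show ?thesis
      using False by (simp add: J si_def wb_def flip: z_def)
  qed
  show thesis
  proof
    have "(\<Sum>\<mu>\<in>{0..2}. E' \<mu>)
        = (\<Sum>k\<in>K. \<Sum>\<mu>\<in>{0..2}. adj (J k) ** E \<mu> ** J k) + (mat 1 - P)"
      by (subst sum.swap) (simp add: E'_def sum.distrib)
    also have "(\<Sum>k\<in>K. \<Sum>\<mu>\<in>{0..2}. adj (J k) ** E \<mu> ** J k)
        = (\<Sum>k\<in>K. adj (J k) ** (\<Sum>\<mu>\<in>{0..2}. E \<mu>) ** J k)"
      by (simp add: matrix_mult_sum_left matrix_mult_sum_right)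
    also have "\<dots> = P"
      using E by (simp add: povm_def JJ)
    finally have "(\<Sum>\<mu>\<in>{0..2}. E' \<mu>) = mat 1" by simp
    moreover have "psd_op (E' \<mu>)" if "\<mu> \<in> {0..2}" for \<mu>
      using E that psdQ unfolding E'_def povm_def
      by (intro psd_op_add psd_op_sum psd_op_conj) (auto simp: psd_op_0)
    ultimately show "povm 2 E'"
      by (simp add: povm_def)
  qed (simp_all add: form Ja1 Ja2)
qed

lemma cinner_unitary: "unitary_op A \<Longrightarrow> cinner (A *v x) (A *v y) = cinner x y"
  by (simp add: cinner_adj matrix_vector_mul_assoc unitary_op_def dagger_eq_adj)

lemma success_prob_2:
  "success_prob 2 \<eta> U \<rho> E
    = \<eta> 1 * outcome_prob (U 1) \<rho> (E 1) + \<eta> 2 * outcome_prob (U 2) \<rho> (E 2)"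
  unfolding success_prob_def atLeast1_atMost2 by simp

lemma error_prob_2:
  "error_prob 2 \<eta> U \<rho> E
    = \<eta> 1 * outcome_prob (U 1) \<rho> (E 2) + \<eta> 2 * outcome_prob (U 2) \<rho> (E 1)"
proof -
  have "{1, 2} - {1} = {2::nat}" "{1, 2} - {2} = {1::nat}" by auto
  then show ?thesis unfolding error_prob_def atLeast1_atMost2 by simp
qed

text \<open>The total overlap of the vectors decomposing \<open>\<rho>\<close> is attained by
  \<open>B\<close> at a single unit vector \<open>x\<close>. Unitarity gives the remaining Gram
  entries, so \<open>povm_pullback\<close> yields a POVM for the pure input \<open>outer x x\<close>
  with the same success and error probabilities. The two dimensions may differ, so the lemma applies
  in both directions between the problems with and without the ancilla.\<close>

lemma success_values_mono:
  fixes A :: "nat \<Rightarrow> 'a::finite cop" and B :: "nat \<Rightarrow> 'b::finite cop"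
  assumes A: "unitary_op (A 1)" "unitary_op (A 2)"
    and B: "unitary_op (B 1)" "unitary_op (B 2)"
    and sub: "overlaps (A 1) (A 2) \<subseteq> overlaps (B 1) (B 2)"
  shows "success_values 2 \<eta> A m \<subseteq> success_values 2 \<eta> B m"
proof
  fix p assume "p \<in> success_values 2 \<eta> A m"
  then obtain \<rho> E where p: "p = success_prob 2 \<eta> A \<rho> E"
    and \<rho>: "density_op \<rho>" and E: "povm 2 E" and m: "error_prob 2 \<eta> A \<rho> E \<le> m"
    unfolding success_values_def by blast
  obtain N :: nat and v where v: "\<rho> = (\<Sum>k<N. outer (v k) (v k))"
    using psd_op_decomp \<rho> unfolding density_op_def by blast
  have one: "(\<Sum>k<N. cinner (v k) (v k)) = 1"
    using \<rho> by (simp add: density_op_def v trace_sum trace_outer)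
  then have "(\<Sum>k<N. (norm (v k))\<^sup>2) = 1"
    by (simp only: sum_cinner_self_eq_1_iff)
  then have "(\<Sum>k<N. cinner (A 1 *v v k) (A 2 *v v k)) \<in> overlaps (B 1) (B 2)"
    using sub sum_overlaps[of "{..<N}" v] by blast
  then obtain x where x: "norm x = 1"
    and ov: "(\<Sum>k<N. cinner (A 1 *v v k) (A 2 *v v k)) = cinner (B 1 *v x) (B 2 *v x)"
    unfolding overlaps_def by blast
  obtain E' where E': "povm 2 E'"
    "\<And>\<mu>. \<mu> \<noteq> 0 \<Longrightarrow> cinner (B 1 *v x) (E' \<mu> *v (B 1 *v x))
        = (\<Sum>k<N. cinner (A 1 *v v k) (E \<mu> *v (A 1 *v v k)))"
    "\<And>\<mu>. \<mu> \<noteq> 0 \<Longrightarrow> cinner (B 2 *v x) (E' \<mu> *v (B 2 *v x))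
        = (\<Sum>k<N. cinner (A 2 *v v k) (E \<mu> *v (A 2 *v v k)))"
    by (rule povm_pullback[OF E _ _ _ _ ov])
       (simp_all only: cinner_unitary A B one, simp_all add: cinner_self x)
  have out: "outcome_prob (B i) (outer x x) (E' j) = outcome_prob (A i) \<rho> (E j)"
    if "i \<in> {1, 2}" "j \<noteq> 0" for i j
    \<comment> \<open>The pure input is treated as a one-term sum indexed by
      \<open>{()}\<close>.\<close>
    using that E'(2,3)[of j] outcome_prob_outer_sum[of "B i" "\<lambda>_. x" "{()}"]
    by (auto simp: v outcome_prob_outer_sum)
  have "density_op (outer x x)"
    using x by (simp add: density_op_def psd_op_outer trace_outer cinner_self)
  moreover have "success_prob 2 \<eta> B (outer x x) E' = p" "error_prob 2 \<eta> B (outer x x) E' \<le> m"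
    using m by (simp_all add: p success_prob_2 error_prob_2 out)
  ultimately show "p \<in> success_values 2 \<eta> B m"
    using E'(1) unfolding success_values_def by blast
qed

section \<open>Adding an ancilla\<close>

text \<open>The ancilla index goes outermost, so that the inner sum runs over a slice with fixed
  \<open>r\<close>.\<close>

lemma sum_prod_UNIV: "(\<Sum>i\<in>UNIV. f i) = (\<Sum>r\<in>UNIV. \<Sum>q\<in>UNIV. f (q, r))"
  for f :: "'q::finite \<times> 'r::finite \<Rightarrow> complex"
proof -
  have "(\<Sum>i\<in>UNIV. f i) = (\<Sum>q\<in>UNIV. \<Sum>r\<in>UNIV. f (q, r))"
    by (simp add: sum.cartesian_product UNIV_Times_UNIV)
  also have "\<dots> = (\<Sum>r\<in>UNIV. \<Sum>q\<in>UNIV. f (q, r))"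
    by (rule sum.swap)
  finally show ?thesis .
qed

lemma tensor_op_mat_1_apply:
  "(tensor_op A (mat 1) *v x) $ (q, r) = (A *v (\<chi> q. x $ (q, r))) $ q"
  for A :: "'q::finite cop" and x :: "complex ^ ('q \<times> 'r::finite)"
proof -
  have "(tensor_op A (mat 1) *v x) $ (q, r)
      = (\<Sum>r'\<in>UNIV. \<Sum>q'\<in>UNIV. A $ q $ q' * (if r = r' then 1 else 0) * x $ (q', r'))"
    by (simp add: matrix_vector_mult_def sum_prod_UNIV tensor_op_def mat_def)
  also have "\<dots> = (\<Sum>r'\<in>UNIV. if r = r' then \<Sum>q'\<in>UNIV. A $ q $ q' * x $ (q', r') else 0)"
    by (intro sum.cong) auto
  finally show ?thesis
    by (simp add: matrix_vector_mult_def)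
qed

text \<open>The tensor product is viewed as an orthogonal sum of copies of the first factor, one
  slice for each basis vector of the ancilla; \<open>tensor_op A (mat 1)\<close> acts on each slice
  as \<open>A\<close>.\<close>

lemma cinner_prod:
  "cinner x y = (\<Sum>r\<in>UNIV. cinner (\<chi> q. x $ (q, r)) (\<chi> q. y $ (q, r)))"
  for x y :: "complex ^ ('q::finite \<times> 'r::finite)"
  by (simp add: cinner_def sum_prod_UNIV)

lemma cinner_tensor_op:
  "cinner (tensor_op A (mat 1) *v x) (tensor_op B (mat 1) *v y)
    = (\<Sum>r\<in>UNIV. cinner (A *v (\<chi> q. x $ (q, r))) (B *v (\<chi> q. y $ (q, r))))"
  for A B :: "'q::finite cop" and x y :: "complex ^ ('q \<times> 'r::finite)"
  by (simp add: cinner_prod tensor_op_mat_1_apply)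

lemma dagger_tensor_op: "dagger (tensor_op A B) = tensor_op (dagger A) (dagger B)"
  by (simp add: dagger_def tensor_op_def vec_eq_iff)

lemma unitary_tensor_op_mat_1:
  fixes A :: "'q::finite cop"
  assumes "unitary_op A"
  shows "unitary_op (tensor_op A (mat 1 :: 'r::finite cop))"
proof -
  have "tensor_op B (mat 1 :: 'r cop) ** tensor_op C (mat 1) = mat 1" if "B ** C = mat 1"
    for B C :: "'q cop"
  proof -
    have C: "(\<chi> q. (tensor_op C (mat 1 :: 'r cop) *v x) $ (q, r)) = C *v (\<chi> q. x $ (q, r))"
      for x r
      by (simp add: vec_eq_iff tensor_op_mat_1_apply)
    have BC: "B *v (C *v y) = y" for y
      using that by (simp add: matrix_vector_mul_assoc)
    have "(tensor_op B (mat 1 :: 'r cop) *v (tensor_op C (mat 1) *v x)) $ (q, r) = x $ (q, r)"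
      for x q r
      unfolding tensor_op_mat_1_apply[of B] C BC by simp
    then have "tensor_op B (mat 1 :: 'r cop) *v (tensor_op C (mat 1) *v x) = x" for x
      by (simp add: vec_eq_iff)
    then show ?thesis
      by (simp add: matrix_eq matrix_vector_mul_assoc[symmetric])
  qed
  then show ?thesis
    using assms by (simp add: unitary_op_def dagger_tensor_op dagger_eq_adj[of "mat 1"] adj_mat_1)
qed

lemma sum_cinner_delta:
  "(\<Sum>r\<in>UNIV. cinner (C *v (if r = r0 then x else 0)) (D *v (if r = r0 then x else 0)))
    = cinner (C *v x) (D *v x)"
  for C D :: "'q::finite cop" and r0 :: "'r::finite"
proof -
  have "cinner (C *v (if r = r0 then x else 0)) (D *v (if r = r0 then x else 0))
      = (if r = r0 then cinner (C *v x) (D *v x) else 0)" for r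
    by simp
  then show ?thesis by simp
qed

text \<open>The slices of a unit vector have squared norms summing to 1, so its overlap is covered
  by \<open>sum_overlaps\<close>. Conversely, a unit vector placed in the single slice
  \<open>r0\<close> keeps its overlap.\<close>

lemma overlaps_tensor_op:
  fixes A B :: "'q::finite cop"
  shows "overlaps (tensor_op A (mat 1 :: 'r::finite cop)) (tensor_op B (mat 1)) = overlaps A B"
    (is "?L = _")
proof
  show "?L \<subseteq> overlaps A B"
  proof
    fix z assume "z \<in> ?L"
    then obtain x :: "complex ^ ('q \<times> 'r)" where x: "norm x = 1"
      "z = cinner (tensor_op A (mat 1) *v x) (tensor_op B (mat 1) *v x)"
      unfolding overlaps_def by blast
    have "(\<Sum>r\<in>UNIV. cinner (\<chi> q. x $ (q, r)) (\<chi> q. x $ (q, r))) = 1"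
      unfolding cinner_prod[symmetric] using x by (simp add: cinner_self)
    then have "(\<Sum>r\<in>UNIV. (norm (\<chi> q. x $ (q, r)))\<^sup>2) = 1"
      by (simp only: sum_cinner_self_eq_1_iff)
    then show "z \<in> overlaps A B"
      unfolding x(2) cinner_tensor_op by (rule sum_overlaps[OF finite])
  qed
next
  show "overlaps A B \<subseteq> ?L"
  proof
    fix z assume "z \<in> overlaps A B"
    then obtain x where x: "norm x = 1" "z = cinner (A *v x) (B *v x)"
      unfolding overlaps_def by blast
    define r0 :: 'r where "r0 = undefined"
    define y :: "complex ^ ('q \<times> 'r)" where "y = (\<chi> i. if snd i = r0 then x $ fst i else 0)"
    have y: "(\<chi> q. y $ (q, r)) = (if r = r0 then x else 0)" for r
      by (simp add: y_def vec_eq_iff)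
    have "cinner y y = 1"
      using sum_cinner_delta[of "mat 1" r0 x "mat 1"] x(1)
      unfolding cinner_prod[of y y] y by (simp add: cinner_self_eq_1_iff)
    then have "norm y = 1"
      by (simp only: cinner_self_eq_1_iff)
    moreover have "z = cinner (tensor_op A (mat 1) *v y) (tensor_op B (mat 1) *v y)"
      unfolding cinner_tensor_op y sum_cinner_delta x(2) ..
    ultimately show "z \<in> ?L" unfolding overlaps_def by blast
  qed
qed

section \<open>Attainment of the maximum\<close>

text \<open>A crude estimate by the sum of the moduli of all entries; it is enough for
  boundedness.\<close>

lemma norm_cop_le:
  fixes A :: "'d::finite cop"
  assumes "\<And>i j. cmod (A $ i $ j) \<le> 1"
  shows "norm A \<le> (real CARD('d))\<^sup>2"
proof -
  have "norm A \<le> (\<Sum>i\<in>UNIV. norm (A $ i))"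
    unfolding norm_vec_def by (rule L2_set_le_sum) simp
  also have "\<dots> \<le> (\<Sum>i\<in>(UNIV::'d set). \<Sum>j\<in>(UNIV::'d set). 1)"
  proof (intro sum_mono)
    fix i
    have "norm (A $ i) \<le> (\<Sum>j\<in>UNIV. cmod (A $ i $ j))"
      unfolding norm_vec_def by (rule L2_set_le_sum) simp
    also have "\<dots> \<le> (\<Sum>j\<in>(UNIV::'d set). 1)"
      by (intro sum_mono assms)
    finally show "norm (A $ i) \<le> (\<Sum>j\<in>(UNIV::'d set). 1)" .
  qed
  finally show ?thesis by (simp add: power2_eq_square)
qed

lemma psd_op_norm_le:
  fixes A :: "'d::finite cop"
  assumes "psd_op A" "\<And>i. Re (A $ i $ i) \<le> 1"
  shows "norm A \<le> (real CARD('d))\<^sup>2"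
proof (rule norm_cop_le)
  fix i j
  show "cmod (A $ i $ j) \<le> 1"
    using psd_op_offdiag[OF assms(1), of i j] assms(2)[of i] assms(2)[of j] by simp
qed

text \<open>\<open>mat 1 - A - B\<close> stands for the inconclusive effect. The diagonals of the
  three operators are nonnegative and add up to 1, so each entry on them is at most 1.\<close>

lemma psd_op_complement_norm_le:
  fixes A B :: "'d::finite cop"
  assumes "psd_op A" "psd_op B" "psd_op (mat 1 - A - B)"
  shows "norm A \<le> (real CARD('d))\<^sup>2"
proof (rule psd_op_norm_le)
  show "Re (A $ i $ i) \<le> 1" for i
    using psd_op_diag(2)[OF assms(2), of i] psd_op_diag(2)[OF assms(3), of i]
    by (simp add: mat_def)
qed fact

lemma density_op_norm_le:
  fixes A :: "'d::finite cop"
  assumes "density_op A"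
  shows "norm A \<le> (real CARD('d))\<^sup>2"
proof (rule psd_op_norm_le)
  show "psd_op A" using assms by (simp add: density_op_def)
  show "Re (A $ i $ i) \<le> 1" for i
  proof -
    have "Re (A $ i $ i) \<le> (\<Sum>j\<in>UNIV. Re (A $ j $ j))"
      by (intro member_le_sum) (auto intro: psd_op_diag(2)[OF \<open>psd_op A\<close>])
    also have "\<dots> = Re (trace A)"
      by (simp add: trace_def)
    finally show ?thesis using assms by (simp add: density_op_def)
  qed
qed

text \<open>Written out in entries, positivity is an intersection of equalities and weak
  inequalities between continuous functions.\<close>

lemma closed_psd_op:
  fixes f :: "'x::topological_space \<Rightarrow> 'd::finite cop"
  assumes "continuous_on UNIV f"
  shows "closed {x. psd_op (f x)}"
  unfolding psd_op_def cinner_def dagger_def vec_eq_iff matrix_vector_mult_def vec_lambda_beta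
  by (intro closed_Collect_conj closed_Collect_all closed_Collect_eq closed_Collect_le
      continuous_intros assms)

lemma continuous_on_outcome_prob [continuous_intros]:
  fixes f g :: "'x::topological_space \<Rightarrow> 'd::finite cop"
  assumes "continuous_on S f" "continuous_on S g"
  shows "continuous_on S (\<lambda>x. outcome_prob A (f x) (g x))"
  unfolding outcome_prob_def trace_def matrix_matrix_mult_def vec_lambda_beta
  by (intro continuous_intros assms)

text \<open>The set is a continuous image of the closed bounded set \<open>C\<close> of triples
  \<open>(\<rho>, E 1, E 2)\<close>. Eliminating \<open>E 0\<close> and ignoring the values of
  \<open>E\<close> above 2 places the strategies in a finite-dimensional space.\<close>

lemma success_values_compact:
  fixes U :: "nat \<Rightarrow> 'd::finite cop"
  shows "compact (success_values 2 \<eta> U m)"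
proof -
  define C where "C = {t :: 'd cop \<times> 'd cop \<times> 'd cop. density_op (fst t)
    \<and> psd_op (fst (snd t)) \<and> psd_op (snd (snd t)) \<and> psd_op (mat 1 - fst (snd t) - snd (snd t))
    \<and> \<eta> 1 * outcome_prob (U 1) (fst t) (snd (snd t))
        + \<eta> 2 * outcome_prob (U 2) (fst t) (fst (snd t)) \<le> m}"
  define h where "h t = \<eta> 1 * outcome_prob (U 1) (fst t) (fst (snd t))
        + \<eta> 2 * outcome_prob (U 2) (fst t) (snd (snd t))" for t :: "'d cop \<times> 'd cop \<times> 'd cop"
  have "success_values 2 \<eta> U m = h ` C"
  proof (intro equalityI subsetI)
    fix p assume "p \<in> success_values 2 \<eta> U m"
    then obtain \<rho> E where p: "p = success_prob 2 \<eta> U \<rho> E"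
      and \<rho>: "density_op \<rho>" and E: "povm 2 E" and m: "error_prob 2 \<eta> U \<rho> E \<le> m"
      unfolding success_values_def by blast
    have "E 0 + E 1 + E 2 = mat 1"
      using E by (simp add: povm_def atLeast0_atMost2 add.assoc)
    then have "mat 1 - E 1 - E 2 = E 0"
      by (metis add_diff_cancel_right' diff_diff_eq add.assoc)
    then have "(\<rho>, E 1, E 2) \<in> C"
      using \<rho> E m by (simp add: C_def povm_def error_prob_2)
    moreover have "p = h (\<rho>, E 1, E 2)"
      by (simp add: p h_def success_prob_2)
    ultimately show "p \<in> h ` C" by blast
  next
    fix p assume "p \<in> h ` C"
    then obtain \<rho> F G where C: "(\<rho>, F, G) \<in> C" and p: "p = h (\<rho>, F, G)"
      by auto
    define E where "E \<mu> = (if \<mu> = 0 then mat 1 - F - G else if \<mu> = 1 then F else G)" for \<mu> :: nat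
    have "povm 2 E"
      using C by (simp add: povm_def atLeast0_atMost2 E_def C_def)
    moreover have "p = success_prob 2 \<eta> U \<rho> E" "error_prob 2 \<eta> U \<rho> E \<le> m"
      using C by (simp_all add: p h_def C_def E_def success_prob_2 error_prob_2)
    moreover have "density_op \<rho>"
      using C by (simp add: C_def)
    ultimately show "p \<in> success_values 2 \<eta> U m"
      unfolding success_values_def by blast
  qed
  moreover have "compact C"
  proof (rule compact_eq_bounded_closed[THEN iffD2], rule conjI)
    let ?B = "cball (0 :: 'd cop) ((real CARD('d))\<^sup>2)"
    have "C \<subseteq> ?B \<times> ?B \<times> ?B"
    proof
      fix t assume t: "t \<in> C"
      have "norm (fst t) \<le> (real CARD('d))\<^sup>2"
        using t by (intro density_op_norm_le) (simp add: C_def)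
      moreover have "norm (fst (snd t)) \<le> (real CARD('d))\<^sup>2"
        using t by (intro psd_op_complement_norm_le[of _ "snd (snd t)"]) (simp_all add: C_def)
      moreover have "norm (snd (snd t)) \<le> (real CARD('d))\<^sup>2"
        using t by (intro psd_op_complement_norm_le[of _ "fst (snd t)"])
          (simp_all add: C_def diff_diff_eq add.commute)
      ultimately show "t \<in> ?B \<times> ?B \<times> ?B"
        by (simp add: mem_Times_iff)
    qed
    then show "bounded C"
      by (rule bounded_subset[rotated]) (intro bounded_Times bounded_cball)
    show "closed C"
      unfolding C_def density_op_def trace_def
      by (intro closed_Collect_conj closed_psd_op closed_Collect_eq closed_Collect_le
          continuous_intros)
  qed
  moreover have "continuous_on C h"
    unfolding h_def by (intro continuous_intros)
  ultimately show ?thesis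
    by (simp add: compact_continuous_image)
qed

text \<open>The strategy that always answers inconclusively never errs, so it meets every
  nonnegative margin.\<close>

lemma success_values_nonempty:
  fixes U :: "nat \<Rightarrow> 'd::finite cop"
  assumes "0 \<le> m"
  shows "success_values 2 \<eta> U m \<noteq> {}"
proof -
  define e :: "complex ^ 'd" where "e = axis undefined 1"
  define E :: "nat \<Rightarrow> 'd cop" where "E \<mu> = (if \<mu> = 0 then mat 1 else 0)" for \<mu>
  have "povm 2 E"
    by (simp add: povm_def E_def psd_op_mat_1 psd_op_0)
  moreover have "density_op (outer e e)"
    by (simp add: density_op_def psd_op_outer trace_outer cinner_self e_def)
  moreover have "outcome_prob A \<rho> 0 = 0" for A \<rho> :: "'d cop"
    by (simp add: outcome_prob_def trace_0[unfolded mat_0])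
  then have "error_prob 2 \<eta> U (outer e e) E \<le> m"
    using assms by (simp add: error_prob_2 E_def)
  ultimately show ?thesis
    unfolding success_values_def by blast
qed

theorem mainTheorem2:
  fixes U :: "nat \<Rightarrow> 'q::finite cop"
    and V :: "nat \<Rightarrow> ('q \<times> 'r::finite) cop"
    and \<eta> :: "nat \<Rightarrow> real"
    and m :: real
  assumes "unitary_op (U 1)" and "unitary_op (U 2)"
    and "0 \<le> \<eta> 1" and "0 \<le> \<eta> 2" and "\<eta> 1 + \<eta> 2 = 1"
    and "0 \<le> m" and "m \<le> 1"
  defines "V \<equiv> \<lambda>i. tensor_op (U i) (mat 1 :: 'r cop)"
  shows "is_max_success 2 \<eta> U m (P_max 2 \<eta> U m)
    \<and> is_max_success 2 \<eta> V m (P_max 2 \<eta> V m)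
    \<and> P_max 2 \<eta> V m = P_max 2 \<eta> U m"
proof -
  have "overlaps (V 1) (V 2) = overlaps (U 1) (U 2)"
    unfolding V_def by (rule overlaps_tensor_op)
  moreover have "unitary_op (V 1)" "unitary_op (V 2)"
    using assms(1,2) by (simp_all add: V_def unitary_tensor_op_mat_1)
  \<comment> \<open>Equality of the overlap sets gives the inclusion of success values in both
    directions.\<close>
  ultimately have eq: "success_values 2 \<eta> V m = success_values 2 \<eta> U m"
    using assms(1,2) by (intro equalityI success_values_mono) simp_all
  obtain p where p: "is_max_success 2 \<eta> U m p"
    using compact_attains_sup[OF success_values_compact success_values_nonempty[OF \<open>0 \<le> m\<close>]]
    unfolding is_max_success_def by metis
  \<comment> \<open>A maximum is unique by antisymmetry, so the definite description in
    \<open>P_max\<close> denotes the attained value.\<close>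
  have "is_max_success 2 \<eta> U m (P_max 2 \<eta> U m)"
    unfolding P_max_def
    by (rule theI[of _ p]) (use p in \<open>auto simp: is_max_success_def intro: antisym\<close>)
  \<comment> \<open>\<open>is_max_success\<close> and \<open>P_max\<close> see the operators only
    through \<open>success_values\<close>, so \<open>eq\<close> transfers everything to
    \<open>V\<close>.\<close>
  then show ?thesis
    by (simp add: is_max_success_def P_max_def eq)
qed

end
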